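(* Let $n\ge 2$, let $s_1,\dots,s_{n+2}$ be constants, and let $$\phi(\zeta)=\alpha_0+\alpha_1\zeta+\dots+\alpha_n\zeta^n,\quad \phi_1(\zeta)=\beta_0+\beta_1\zeta+\dots+\beta_n\zeta^n,\quad \phi_2(\zeta)=\gamma_0+\gamma_1\zeta+\dots+\gamma_n\zeta^n$$ be three linearly independent solutions of the linear system (L) of the context (coefficients being functions of $u_1,\dots,u_n$). Let $F,G,H$ be functions of $(\zeta,u_1,\dots,u_n)$ satisfying, for $i=1,\dots,n$, $$F_\zeta=\frac{\phi(\zeta)}{W(\zeta)},\quad F_{u_i}=-\frac{\phi(u_i)}{D_i}\frac{P_i(\zeta)}{W(\zeta)};\qquad G_\zeta=\frac{\phi_1(\zeta)}{W(\zeta)},\quad G_{u_i}=-\frac{\phi_1(u_i)}{D_i}\frac{P_i(\zeta)}{W(\zeta)};\qquad H_\zeta=\frac{\phi_2(\zeta)}{W(\zeta)},\quad H_{u_i}=-\frac{\phi_2(u_i)}{D_i}\frac{P_i(\zeta)}{W(\zeta)}.$$ Then the system for $\mathbf u=(u_1,\dots,u_n)$ with pseudopotential $\Psi_y=F$, $\Psi_t=G$, $\Psi_x=H$ can be written in the form $$\sum_{i,j,k}\frac{u_i^{\,j+l}}{\prod_{m\ne i}(u_i-u_m)}\Big((\gamma_j\alpha_k-\gamma_k\alpha_j)u_{it}+(\alpha_j\beta_k-\alpha_k\beta_j)u_{ix}+(\beta_j\gamma_k-\beta_k\gamma_j)u_{iy}\Big)=0,$$ where the summation is over $i,j,k$ subject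 to the constraints $1\le i\le n$, $0\le j\le l<k\le n$ with fixed $l$; for each $l=1,\dots,n$ there is one equation.
   Context: We work where $u_1,\dots,u_n$ are pairwise distinct and different from $0,1$. Subscripts $\zeta,u_i,t,x,y$ denote partial derivatives. Notation: $$W(\zeta)=\zeta^{s_1}(\zeta-1)^{s_2}\prod_{m=1}^n(\zeta-u_m)^{s_{m+2}},\quad P_i(\zeta)=\zeta(\zeta-1)\prod_{m\ne i}(\zeta-u_m),\quad D_i=P_i(u_i)=u_i(u_i-1)\prod_{m\neq i}(u_i-u_m).$$ The linear system (L) for a polynomial $\phi(\zeta)=\alpha_0(\mathbf u)+\alpha_1(\mathbf u)\zeta+\dots+\alpha_n(\mathbf u)\zeta^n$ is $$\phi_{u_i}(\zeta)=\phi(u_i)\frac{P_i(\zeta)}{D_i}\left(\frac{s_1-1}{\zeta}+\frac{s_2-1}{\zeta-1}+\frac{s_{i+2}}{\zeta-u_i}+\sum_{m\ne i}\frac{s_{m+2}-1}{\zeta-u_m}\right)-\frac{s_{i+2}}{\zeta-u_i}\phi(\zeta),\quad i=1,\dots,n,$$ where $\phi_{u_i}(\zeta)=\sum_k \alpha_{k,u_i}\zeta^k$. It is a linear system of PDEs for $\alpha_0,\dots,\alpha_n$, it is in involution and has $n+1$ linearly independent solutions. (L) is the condition for the equations defining $F$ (resp. $G$, $H$) to be in involution. For a system $\Psi_y=F(\zeta,\mathbf u)$, $\Psi_t=G(\zeta,\mathbf u)$, $\Psi_x=H(\zeta,\mathbf u)$, where $\zeta$ is a parameter to be eliminated (expressed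 through $\Psi_y$ from the first equation) and $\mathbf u=\mathbf u(x,y,t)$, the compatibility condition is $$\sum_{i=1}^n(H_{\zeta}G_{u_i}-G_{\zeta}H_{u_i})u_{iy}+\sum_{i=1}^n(F_{\zeta}H_{u_i}-H_{\zeta}F_{u_i})u_{it}+\sum_{i=1}^n(G_{\zeta}F_{u_i}-F_{\zeta}G_{u_i})u_{ix}=0$$ identically in $\zeta$. The system for $\mathbf u$ with this pseudopotential is the quasilinear system equivalent to this compatibility condition.
   Formalization: The displayed system is corrected: exponent j+l becomes j+k-l-1, the denominator gains the factor u_i(u_i-1), and l runs over 0,...,n-1 instead of 1,...,n; as printed, l=n gives 0=0, leaving at most n-1 equations where n independent ones are needed. *)

theory Defs
  imports "HOL-Analysis.Analysis" "HOL-Computational_Algebra.Polynomial"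
begin

text \<open>
  The finite type \<^typ>\<open>'n\<close> is the index set of \<open>u\<^sub>1, \<dots>, u\<^sub>n\<close>, so \<open>n = CARD('n)\<close>. Of the constants
  \<open>s\<^sub>1, \<dots>, s\<^sub>n\<^sub>+\<^sub>2\<close>, the first two are \<open>s1\<close> and \<open>s2\<close>, and \<open>s\<^sub>m\<^sub>+\<^sub>2\<close>, which belongs to \<open>u\<^sub>m\<close>, is \<open>s m\<close>.
  All quantities are complex.
\<close>

definition subst_coord :: "complex ^ 'n \<Rightarrow> 'n \<Rightarrow> complex \<Rightarrow> complex ^ 'n"
  where "subst_coord u i z = (\<chi> j. if j = i then z else u $ j)"

definition has_partial :: "(complex ^ 'n \<Rightarrow> complex) \<Rightarrow> 'n \<Rightarrow> complex \<Rightarrow> complex ^ 'n \<Rightarrow> bool"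
  where "has_partial f i d u \<longleftrightarrow> ((\<lambda>z. f (subst_coord u i z)) has_field_derivative d) (at (u $ i))"

definition partial :: "'n \<Rightarrow> (complex ^ 'n \<Rightarrow> complex) \<Rightarrow> complex ^ 'n \<Rightarrow> complex"
  where "partial i f u = deriv (\<lambda>z. f (subst_coord u i z)) (u $ i)"

definition admissible :: "complex ^ 'n \<Rightarrow> bool"
  where "admissible u \<longleftrightarrow> inj (($) u) \<and> (\<forall>i. u $ i \<noteq> 0 \<and> u $ i \<noteq> 1)"

definition P :: "complex ^ 'n \<Rightarrow> 'n \<Rightarrow> complex \<Rightarrow> complex"
  where "P u i \<zeta> = \<zeta> * (\<zeta> - 1) * (\<Prod>m \<in> UNIV - {i}. \<zeta> - u $ m)"

definition D :: "complex ^ 'n \<Rightarrow> 'n \<Rightarrow> complex"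
  where "D u i = P u i (u $ i)"

text \<open>
  \<open>W\<close> is multivalued for non-integral exponents. On a given set of points \<open>(\<zeta>, u)\<close> it is read as
  any branch coming from continuous branches \<open>L0, L1, L m\<close> of the logarithms of \<open>\<zeta>\<close>, \<open>\<zeta> - 1\<close> and
  \<open>\<zeta> - u\<^sub>m\<close>. Their existence forces these quantities to be nonzero there.
\<close>

definition branch_of_log ::
    "(complex \<times> (complex ^ 'n) \<Rightarrow> complex) \<Rightarrow> (complex \<times> (complex ^ 'n) \<Rightarrow> complex)
      \<Rightarrow> (complex \<times> (complex ^ 'n)) set \<Rightarrow> bool"
  where "branch_of_log L f \<Omega> \<longleftrightarrow> continuous_on \<Omega> L \<and> (\<forall>p\<in>\<Omega>. exp (L p) = f p)"

definition branch_of_W ::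
    "complex \<Rightarrow> complex \<Rightarrow> ('n \<Rightarrow> complex) \<Rightarrow> (complex \<times> (complex ^ 'n)) set
      \<Rightarrow> (complex \<Rightarrow> complex ^ 'n \<Rightarrow> complex) \<Rightarrow> bool"
  where "branch_of_W s1 s2 s \<Omega> W \<longleftrightarrow>
    (\<exists>L0 L1 L.
      branch_of_log L0 (\<lambda>(\<zeta>, u). \<zeta>) \<Omega> \<and>
      branch_of_log L1 (\<lambda>(\<zeta>, u). \<zeta> - 1) \<Omega> \<and>
      (\<forall>m. branch_of_log (L m) (\<lambda>(\<zeta>, u). \<zeta> - u $ m) \<Omega>) \<and>
      (\<forall>(\<zeta>, u) \<in> \<Omega>. W \<zeta> u =
        exp (s1 * L0 (\<zeta>, u)) * exp (s2 * L1 (\<zeta>, u)) * (\<Prod>m\<in>UNIV. exp (s m * L m (\<zeta>, u)))))"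

text \<open>
  The linear system (L) on \<open>U\<close>. Both sides are polynomial in \<open>\<zeta>\<close> once the poles on the right are
  cancelled, so it is enough to impose it away from these poles.
\<close>

definition solves_L ::
    "complex \<Rightarrow> complex \<Rightarrow> ('n \<Rightarrow> complex) \<Rightarrow> (complex ^ 'n) set
      \<Rightarrow> (complex ^ 'n \<Rightarrow> complex poly) \<Rightarrow> bool"
  where "solves_L s1 s2 s U \<phi> \<longleftrightarrow>
    (\<forall>u\<in>U. degree (\<phi> u) \<le> CARD('n) \<and>
      (\<forall>i k. \<exists>d. has_partial (\<lambda>v. coeff (\<phi> v) k) i d u) \<and>
      (\<forall>i \<zeta>. \<zeta> \<noteq> 0 \<and> \<zeta> \<noteq> 1 \<and> (\<forall>m. \<zeta> \<noteq> u $ m) \<longrightarrow>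
        (\<Sum>k\<le>CARD('n). partial i (\<lambda>v. coeff (\<phi> v) k) u * \<zeta> ^ k) =
          poly (\<phi> u) (u $ i) * (P u i \<zeta> / D u i)
            * ((s1 - 1) / \<zeta> + (s2 - 1) / (\<zeta> - 1) + s i / (\<zeta> - u $ i)
                + (\<Sum>m \<in> UNIV - {i}. (s m - 1) / (\<zeta> - u $ m)))
          - s i / (\<zeta> - u $ i) * poly (\<phi> u) \<zeta>))"

definition lin_indep3 ::
    "(complex ^ 'n) set \<Rightarrow> (complex ^ 'n \<Rightarrow> complex poly) \<Rightarrow> (complex ^ 'n \<Rightarrow> complex poly)
      \<Rightarrow> (complex ^ 'n \<Rightarrow> complex poly) \<Rightarrow> bool"
  where "lin_indep3 U \<phi> \<phi>1 \<phi>2 \<longleftrightarrow>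
    (\<forall>a b c :: complex.
      (\<forall>u\<in>U. smult a (\<phi> u) + smult b (\<phi>1 u) + smult c (\<phi>2 u) = 0) \<longrightarrow> a = 0 \<and> b = 0 \<and> c = 0)"

definition is_potential ::
    "(complex \<times> (complex ^ 'n)) set \<Rightarrow> (complex \<Rightarrow> complex ^ 'n \<Rightarrow> complex)
      \<Rightarrow> (complex ^ 'n \<Rightarrow> complex poly) \<Rightarrow> (complex \<Rightarrow> complex ^ 'n \<Rightarrow> complex) \<Rightarrow> bool"
  where "is_potential \<Omega> W \<phi> F \<longleftrightarrow>
    (\<forall>(\<zeta>, u) \<in> \<Omega>.
      ((\<lambda>z. F z u) has_field_derivative poly (\<phi> u) \<zeta> / W \<zeta> u) (at \<zeta>) \<and>
      (\<forall>i. has_partial (F \<zeta>) i (- (poly (\<phi> u) (u $ i) / D u i) * (P u i \<zeta> / W \<zeta> u)) u))"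

text \<open>
  First-order conditions on a function \<open>u(x, y, t)\<close> enter only through its value \<open>u\<close> and the vectors
  \<open>ux\<close>, \<open>uy\<close>, \<open>ut\<close> of its partial derivatives. In the following condition, \<open>\<zeta>\<close> runs over all values
  for which \<open>F\<close>, \<open>G\<close>, \<open>H\<close> are defined at \<open>(\<zeta>, u)\<close>.
\<close>

definition compatible ::
    "(complex \<times> (complex ^ 'n)) set
      \<Rightarrow> (complex \<Rightarrow> complex ^ 'n \<Rightarrow> complex) \<Rightarrow> (complex \<Rightarrow> complex ^ 'n \<Rightarrow> complex)
      \<Rightarrow> (complex \<Rightarrow> complex ^ 'n \<Rightarrow> complex)
      \<Rightarrow> complex ^ 'n \<Rightarrow> complex ^ 'n \<Rightarrow> complex ^ 'n \<Rightarrow> complex ^ 'n \<Rightarrow> bool"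
  where "compatible \<Omega> F G H u ux uy ut \<longleftrightarrow>
    (\<forall>\<zeta>. (\<zeta>, u) \<in> \<Omega> \<longrightarrow>
      (let F\<^sub>\<zeta> = deriv (\<lambda>z. F z u) \<zeta>; G\<^sub>\<zeta> = deriv (\<lambda>z. G z u) \<zeta>; H\<^sub>\<zeta> = deriv (\<lambda>z. H z u) \<zeta>
       in (\<Sum>i\<in>UNIV. (H\<^sub>\<zeta> * partial i (G \<zeta>) u - G\<^sub>\<zeta> * partial i (H \<zeta>) u) * uy $ i)
        + (\<Sum>i\<in>UNIV. (F\<^sub>\<zeta> * partial i (H \<zeta>) u - H\<^sub>\<zeta> * partial i (F \<zeta>) u) * ut $ i)
        + (\<Sum>i\<in>UNIV. (G\<^sub>\<zeta> * partial i (F \<zeta>) u - F\<^sub>\<zeta> * partial i (G \<zeta>) u) * ux $ i) = 0))"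

text \<open>
  The explicit form of the system, one equation for each \<open>l < n\<close>, in the coefficients \<open>\<alpha>, \<beta>, \<gamma>\<close> of
  \<open>\<phi>, \<phi>\<^sub>1, \<phi>\<^sub>2\<close> at the point \<open>u\<close>. The summand comes from
  \<open>(\<zeta>^k u\<^sub>i^j - \<zeta>^j u\<^sub>i^k) / (\<zeta> - u\<^sub>i) = (\<Sum>l = j..<k. \<zeta>^l u\<^sub>i^(j + k - l - 1))\<close> for \<open>j < k\<close>, and its
  denominator is \<open>D\<^sub>i\<close>. The published formula has \<open>u\<^sub>i^(j + l)\<close>, omits \<open>u\<^sub>i (u\<^sub>i - 1)\<close> and lets \<open>l\<close> run
  over \<open>1, \<dots>, n\<close>. That is a misprint: its equation for \<open>l = n\<close> is \<open>0 = 0\<close>, so it has at most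
  \<open>n - 1\<close> nontrivial equations and is not equivalent to the compatibility condition.
\<close>

definition coeff_system_eq ::
    "complex poly \<Rightarrow> complex poly \<Rightarrow> complex poly \<Rightarrow> nat
      \<Rightarrow> complex ^ 'n \<Rightarrow> complex ^ 'n \<Rightarrow> complex ^ 'n \<Rightarrow> complex ^ 'n \<Rightarrow> bool"
  where "coeff_system_eq p p1 p2 l u ux uy ut \<longleftrightarrow>
    (let \<alpha> = coeff p; \<beta> = coeff p1; \<gamma> = coeff p2
     in (\<Sum>i\<in>UNIV. \<Sum>j = 0..l. \<Sum>k = l + 1..CARD('n).
          u $ i ^ (j + k - l - 1) / (u $ i * (u $ i - 1) * (\<Prod>m \<in> UNIV - {i}. u $ i - u $ m))
          * ((\<gamma> j * \<alpha> k - \<gamma> k * \<alpha> j) * ut $ i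
             + (\<alpha> j * \<beta> k - \<alpha> k * \<beta> j) * ux $ i
             + (\<beta> j * \<gamma> k - \<beta> k * \<gamma> j) * uy $ i)) = 0)"

end

theory Submission
  imports Defs
begin

text \<open>
  For polynomials \<open>p, q\<close> the difference \<open>p(a) q(\<zeta>) - p(\<zeta>) q(a)\<close> is divisible by \<open>\<zeta> - a\<close>. With
  \<open>a = u\<^sub>i\<close> the factor \<open>\<zeta> - u\<^sub>i\<close> completes \<open>P\<^sub>i(\<zeta>)\<close> to the full product
  \<open>Q(\<zeta>) = \<zeta> (\<zeta> - 1) (\<Prod>m. \<zeta> - u\<^sub>m)\<close>, which does not depend on \<open>i\<close>. Hence the left-hand side of the
  compatibility condition is \<open>- Q(\<zeta>) / W(\<zeta>)\<^sup>2\<close> times a polynomial of degree less than \<open>n\<close> in \<open>\<zeta>\<close>,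
  whose coefficients are the left-hand sides of the explicit equations. It vanishes on a nonempty
  open set of \<open>\<zeta>\<close> iff all these coefficients vanish.
\<close>

text \<open>Coefficient of z^l in the Bezoutian (p(a) q(z) - p(z) q(a)) / (z - a), when
  \<open>n\<close> bounds both degrees. Using a bound \<open>n\<close> in place of the actual
  degrees gives all pairs among three polynomials the same index range. The exponent is never
  truncated, since k is at least l + 1.\<close>

definition bezout_coeff :: "nat \<Rightarrow> 'a::comm_ring_1 poly \<Rightarrow> 'a poly \<Rightarrow> 'a \<Rightarrow> nat \<Rightarrow> 'a"
  where "bezout_coeff n p q a l =
    (\<Sum>j = 0..l. \<Sum>k = l + 1..n.
      a ^ (j + k - l - 1) * (coeff p j * coeff q k - coeff p k * coeff q j))"

text \<open>Taking out a^j z^j leaves z^(k-j) - a^(k-j), which has the geometric factorization;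
  shifting its index by j absorbs the monomial taken out.\<close>

lemma power_mult_power_diff:
  fixes a z :: "'a::comm_ring_1"
  assumes "j < k"
  shows "a ^ j * z ^ k - z ^ j * a ^ k = (z - a) * (\<Sum>l = j..<k. a ^ (j + k - l - 1) * z ^ l)"
proof -
  have k: "k = (k - j) + j" using assms by simp
  have "a ^ j * z ^ k - z ^ j * a ^ k = a ^ j * z ^ j * (z ^ (k - j) - a ^ (k - j))"
    by (subst (1 2) k) (simp only: power_add algebra_simps)
  also have "\<dots> = (z - a) * (\<Sum>i<k - j. a ^ j * z ^ j * (a ^ (k - j - Suc i) * z ^ i))"
    by (simp add: power_diff_sumr2 sum_distrib_left mult.left_commute)
  also have "(\<Sum>i<k - j. a ^ j * z ^ j * (a ^ (k - j - Suc i) * z ^ i))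
      = (\<Sum>l = j..<k. a ^ (j + k - l - 1) * z ^ l)"
  proof (rule sum.reindex_bij_witness[of _ "\<lambda>l. l - j" "\<lambda>i. i + j"])
    fix i assume "i \<in> {..<k - j}"
    \<comment> \<open>Both exponents are k - i - 1; the bound i < k - j keeps the natural-number
      subtractions exact.\<close>
    then have "j + k - (i + j) - 1 = j + (k - j - Suc i)" by auto
    then show "a ^ (j + k - (i + j) - 1) * z ^ (i + j) = a ^ j * z ^ j * (a ^ (k - j - Suc i) * z ^ i)"
      by (simp add: power_add mult_ac)
  qed auto
  finally show ?thesis .
qed

text \<open>The diagonal contributes nothing, and reflecting the part below it pairs each entry (k,
  j) with (j, k).\<close>

lemma sum_square_triangle:
  fixes f :: "nat \<Rightarrow> nat \<Rightarrow> 'a::comm_monoid_add"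
  assumes "\<And>j. f j j = 0"
  shows "(\<Sum>j\<le>n. \<Sum>k\<le>n. f j k) = (\<Sum>j\<le>n. \<Sum>k\<in>{j<..n}. f j k + f k j)"
proof -
  have "(\<Sum>k\<le>n. f j k) = (\<Sum>k<j. f j k) + (\<Sum>k\<in>{j<..n}. f j k)" if "j \<le> n" for j
  proof -
    have "{..n} = insert j ({..<j} \<union> {j<..n})" using that by auto
    moreover have "sum (f j) ({..<j} \<union> {j<..n}) = sum (f j) {..<j} + sum (f j) {j<..n}"
      by (rule sum.union_disjoint) auto
    ultimately show ?thesis using assms by simp
  qed
  then have "(\<Sum>j\<le>n. \<Sum>k\<le>n. f j k) = (\<Sum>j\<le>n. \<Sum>k<j. f j k) + (\<Sum>j\<le>n. \<Sum>k\<in>{j<..n}. f j k)"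
    by (simp add: sum.distrib)
  also have "(\<Sum>j\<le>n. \<Sum>k<j. f j k) = (\<Sum>k\<le>n. \<Sum>j\<in>{k<..n}. f j k)"
    by (simp add: sum.Sigma)
      (rule sum.reindex_bij_witness[of _ "\<lambda>(k, j). (j, k)" "\<lambda>(j, k). (k, j)"]; auto)
  finally show ?thesis by (simp add: sum.distrib add.commute)
qed

text \<open>Expanding both products gives a double sum whose coefficients \<open>c j k\<close> are
  antisymmetric. Pairing (j, k) with (k, j) therefore leaves differences of monomials, each
  divisible by z - a.\<close>

lemma poly_bezout:
  fixes p q :: "'a::comm_ring_1 poly"
  assumes "degree p \<le> n" "degree q \<le> n"
  shows "poly p a * poly q z - poly p z * poly q a = (z - a) * (\<Sum>l<n. bezout_coeff n p q a l * z ^ l)"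
proof -
  define c where "c j k = coeff p j * coeff q k - coeff p k * coeff q j" for j k
  have poly_sum: "poly r x = (\<Sum>k\<le>n. coeff r k * x ^ k)" if "degree r \<le> n" for r and x :: 'a
    using that by (subst poly_as_sum_of_monoms'[OF that, symmetric]) (simp add: poly_sum poly_monom)
  have "poly p a * poly q z - poly p z * poly q a = (\<Sum>j\<le>n. \<Sum>k\<le>n. c j k * (a ^ j * z ^ k))"
  proof -
    have "poly p z * poly q a = (\<Sum>j\<le>n. \<Sum>k\<le>n. coeff p k * coeff q j * (a ^ j * z ^ k))"
      by (simp add: poly_sum assms sum_product mult_ac) (rule sum.swap)
    moreover have "poly p a * poly q z = (\<Sum>j\<le>n. \<Sum>k\<le>n. coeff p j * coeff q k * (a ^ j * z ^ k))"
      by (simp add: poly_sum assms sum_product mult_ac)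
    ultimately show ?thesis by (simp add: c_def sum_subtractf left_diff_distrib)
  qed
  also have "\<dots> = (\<Sum>j\<le>n. \<Sum>k\<in>{j<..n}. c j k * (a ^ j * z ^ k) + c k j * (a ^ k * z ^ j))"
    by (rule sum_square_triangle) (simp add: c_def)
  also have "\<dots> = (\<Sum>j\<le>n. \<Sum>k\<in>{j<..n}. c j k * (a ^ j * z ^ k - z ^ j * a ^ k))"
    by (intro sum.cong refl) (simp add: c_def algebra_simps)
  also have "\<dots> = (z - a) * (\<Sum>j\<le>n. \<Sum>k\<in>{j<..n}. \<Sum>l = j..<k. c j k * (a ^ (j + k - l - 1) * z ^ l))"
    by (simp add: power_mult_power_diff sum_distrib_left mult.left_commute)
  \<comment> \<open>Both sides run over the triples with j \<le> l < k \<le> n; these inequalities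
    already force l < n.\<close>
  also have "(\<Sum>j\<le>n. \<Sum>k\<in>{j<..n}. \<Sum>l = j..<k. c j k * (a ^ (j + k - l - 1) * z ^ l))
      = (\<Sum>l<n. \<Sum>j = 0..l. \<Sum>k = l + 1..n. c j k * (a ^ (j + k - l - 1) * z ^ l))"
    by (simp add: sum.Sigma)
      (rule sum.reindex_bij_witness[of _ "\<lambda>(l, j, k). (j, k, l)" "\<lambda>(j, k, l). (l, j, k)"]; auto)
  also have "\<dots> = (\<Sum>l<n. bezout_coeff n p q a l * z ^ l)"
    unfolding bezout_coeff_def sum_distrib_right by (simp add: c_def mult_ac)
  finally show ?thesis .
qed

text \<open>The brackets at \<open>ut\<close>, \<open>ux\<close>, \<open>uy\<close> are the
  antisymmetric coefficients of the cyclic pairs (p2, p), (p, p1), (p1, p2).\<close>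

lemma coeff_system_eq_iff_bezout:
  fixes v :: "complex ^ 'n::finite"
  shows "coeff_system_eq p p1 p2 l v ux uy ut \<longleftrightarrow>
    (\<Sum>i\<in>UNIV. (bezout_coeff CARD('n) p2 p (v $ i) l * ut $ i
      + bezout_coeff CARD('n) p p1 (v $ i) l * ux $ i
      + bezout_coeff CARD('n) p1 p2 (v $ i) l * uy $ i) / D v i) = 0"
proof -
  have D: "v $ i * (v $ i - 1) * (\<Prod>m\<in>UNIV - {i}. v $ i - v $ m) = D v i" for i
    by (simp add: D_def P_def)
  show ?thesis
    unfolding coeff_system_eq_def Let_def D bezout_coeff_def add_divide_distrib
      sum_distrib_right sum_divide_distrib sum.distrib[symmetric]
    by (intro arg_cong[where f = "\<lambda>x. x = 0"] sum.cong refl)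
      (simp add: algebra_simps add_divide_distrib diff_divide_distrib)
qed

text \<open>A nonempty open subset of the complex plane is infinite, whereas a nonzero polynomial
  has finitely many roots.\<close>

lemma polyfun_zero_on_open_iff:
  fixes c :: "nat \<Rightarrow> complex"
  assumes "open S" "S \<noteq> {}"
  shows "(\<forall>z\<in>S. (\<Sum>l<n. c l * z ^ l) = 0) \<longleftrightarrow> (\<forall>l<n. c l = 0)"
proof
  assume vanish: "\<forall>z\<in>S. (\<Sum>l<n. c l * z ^ l) = 0"
  show "\<forall>l<n. c l = 0"
  proof (cases n)
    case (Suc m)
    have "infinite S"
      using assms finite_imp_not_open by blast
    moreover have "S \<subseteq> {z. (\<Sum>l\<le>m. c l * z ^ l) = 0}"
      using vanish by (auto simp: Suc lessThan_Suc_atMost)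
    ultimately have "infinite {z. (\<Sum>l\<le>m. c l * z ^ l) = 0}"
      using finite_subset by blast
    then show ?thesis
      using polyfun_finite_roots[of c m] by (auto simp: Suc less_Suc_eq_le)
  qed simp
qed simp

text \<open>All these quantities are exponentials or products of exponentials. The result allows the
  common factor in the compatibility condition to be cancelled.\<close>

lemma branch_of_W_nonzero:
  fixes v :: "complex ^ 'n::finite"
  assumes "branch_of_W s1 s2 s \<Omega> W" "(\<zeta>, v) \<in> \<Omega>"
  shows "W \<zeta> v \<noteq> 0" "\<zeta> \<noteq> 0" "\<zeta> \<noteq> 1" "\<zeta> \<noteq> v $ m"
proof -
  obtain L0 L1 L where L:
      "branch_of_log L0 (\<lambda>(\<zeta>, u). \<zeta>) \<Omega>" "branch_of_log L1 (\<lambda>(\<zeta>, u). \<zeta> - 1) \<Omega>"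
      "\<forall>m. branch_of_log (L m) (\<lambda>(\<zeta>, u). \<zeta> - u $ m) \<Omega>"
      "\<forall>(\<zeta>, u) \<in> \<Omega>. W \<zeta> u =
        exp (s1 * L0 (\<zeta>, u)) * exp (s2 * L1 (\<zeta>, u)) * (\<Prod>m\<in>UNIV. exp (s m * L m (\<zeta>, u)))"
    using assms(1) unfolding branch_of_W_def by blast
  show "W \<zeta> v \<noteq> 0"
    using L(4) assms(2) by auto
  have "exp (L0 (\<zeta>, v)) = \<zeta>" "exp (L1 (\<zeta>, v)) = \<zeta> - 1" "exp (L m (\<zeta>, v)) = \<zeta> - v $ m"
    using L(1-3) assms(2) unfolding branch_of_log_def by fastforce+
  then show "\<zeta> \<noteq> 0" "\<zeta> \<noteq> 1" "\<zeta> \<noteq> v $ m"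
    by (metis exp_not_eq_zero, metis exp_not_eq_zero diff_self, metis exp_not_eq_zero diff_self)
qed

lemma is_potential_derivs:
  assumes "is_potential \<Omega> W \<phi> F" "(\<zeta>, v) \<in> \<Omega>"
  shows "deriv (\<lambda>z. F z v) \<zeta> = poly (\<phi> v) \<zeta> / W \<zeta> v"
    and "partial i (F \<zeta>) v = - (poly (\<phi> v) (v $ i) / D v i) * (P v i \<zeta> / W \<zeta> v)"
  using assms unfolding is_potential_def has_partial_def partial_def
  by (auto intro!: DERIV_imp_deriv)

lemma P_mult_diff:
  fixes v :: "complex ^ 'n::finite"
  shows "P v i \<zeta> * (\<zeta> - v $ i) = \<zeta> * (\<zeta> - 1) * (\<Prod>m\<in>UNIV. \<zeta> - v $ m)"
  by (simp add: P_def prod.remove[of UNIV i])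

text \<open>Each product of derivatives carries P_i / W^2, and what remains is p(u_i) q(\<zeta>) -
  p(\<zeta>) q(u_i) over D_i. The resulting prefactor depends neither on i nor on the pair of
  potentials.\<close>

lemma potential_bracket:
  fixes v :: "complex ^ 'n::finite"
  assumes "is_potential \<Omega> W p F" "is_potential \<Omega> W q G" "(\<zeta>, v) \<in> \<Omega>"
    and "degree (p v) \<le> CARD('n)" "degree (q v) \<le> CARD('n)"
  shows "deriv (\<lambda>z. G z v) \<zeta> * partial i (F \<zeta>) v - deriv (\<lambda>z. F z v) \<zeta> * partial i (G \<zeta>) v
    = - (\<zeta> * (\<zeta> - 1) * (\<Prod>m\<in>UNIV. \<zeta> - v $ m) / (W \<zeta> v)\<^sup>2)
        * ((\<Sum>l<CARD('n). bezout_coeff CARD('n) (p v) (q v) (v $ i) l * \<zeta> ^ l) / D v i)"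
    (is "?lhs = - (?Q / _) * (?S / _)")
proof -
  have "?lhs = - (P v i \<zeta> / (W \<zeta> v)\<^sup>2)
      * ((poly (p v) (v $ i) * poly (q v) \<zeta> - poly (p v) \<zeta> * poly (q v) (v $ i)) / D v i)"
    by (simp add: is_potential_derivs[OF assms(1,3)] is_potential_derivs[OF assms(2,3)]
        power2_eq_square diff_divide_distrib algebra_simps)
  also have "\<dots> = - (P v i \<zeta> * (\<zeta> - v $ i) / (W \<zeta> v)\<^sup>2) * (?S / D v i)"
    by (simp add: poly_bezout[OF assms(4,5)])
  finally show ?thesis by (simp only: P_mult_diff)
qed

text \<open>The equivalence is pointwise: the derivatives of u enter as arbitrary vectors
  \<open>ux\<close>, \<open>uy\<close>, \<open>ut\<close>, and the theorem specializes v to u(x, y,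
  t).\<close>

lemma compatible_iff_coeff_system:
  fixes v :: "complex ^ 'n::finite"
  assumes "open \<Omega>" "v \<in> snd ` \<Omega>" "branch_of_W s1 s2 s \<Omega> W"
    and pot: "is_potential \<Omega> W \<phi> F" "is_potential \<Omega> W \<phi>1 G" "is_potential \<Omega> W \<phi>2 H"
    and deg: "degree (\<phi> v) \<le> CARD('n)" "degree (\<phi>1 v) \<le> CARD('n)" "degree (\<phi>2 v) \<le> CARD('n)"
  shows "compatible \<Omega> F G H v ux uy ut \<longleftrightarrow>
    (\<forall>l < CARD('n). coeff_system_eq (\<phi> v) (\<phi>1 v) (\<phi>2 v) l v ux uy ut)"
proof -
  let ?n = "CARD('n)"
  \<comment> \<open>The slice of \<Omega> over v, open as a preimage and nonempty because v lies in
    the projection of \<Omega>.\<close>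
  define S where "S = {\<zeta>. (\<zeta>, v) \<in> \<Omega>}"
  define E where "E l = (\<Sum>i\<in>UNIV. (bezout_coeff ?n (\<phi>2 v) (\<phi> v) (v $ i) l * ut $ i
      + bezout_coeff ?n (\<phi> v) (\<phi>1 v) (v $ i) l * ux $ i
      + bezout_coeff ?n (\<phi>1 v) (\<phi>2 v) (v $ i) l * uy $ i) / D v i)" for l
  have "S = (\<lambda>\<zeta>. (\<zeta>, v)) -` \<Omega>" by (auto simp: S_def)
  then have "open S"
    using assms(1) by (auto intro!: open_vimage continuous_intros)
  moreover have "S \<noteq> {}"
    using assms(2) by (auto simp: S_def)
  moreover have "compatible \<Omega> F G H v ux uy ut \<longleftrightarrow> (\<forall>\<zeta>\<in>S. (\<Sum>l<?n. E l * \<zeta> ^ l) = 0)"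
  proof -
    have "(let F\<^sub>\<zeta> = deriv (\<lambda>z. F z v) \<zeta>; G\<^sub>\<zeta> = deriv (\<lambda>z. G z v) \<zeta>; H\<^sub>\<zeta> = deriv (\<lambda>z. H z v) \<zeta>
       in (\<Sum>i\<in>UNIV. (H\<^sub>\<zeta> * partial i (G \<zeta>) v - G\<^sub>\<zeta> * partial i (H \<zeta>) v) * uy $ i)
        + (\<Sum>i\<in>UNIV. (F\<^sub>\<zeta> * partial i (H \<zeta>) v - H\<^sub>\<zeta> * partial i (F \<zeta>) v) * ut $ i)
        + (\<Sum>i\<in>UNIV. (G\<^sub>\<zeta> * partial i (F \<zeta>) v - F\<^sub>\<zeta> * partial i (G \<zeta>) v) * ux $ i) = 0)
      \<longleftrightarrow> (\<Sum>l<?n. E l * \<zeta> ^ l) = 0" if mem: "(\<zeta>, v) \<in> \<Omega>" for \<zeta>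
    proof -
      \<comment> \<open>The prefactor shared by all three sums; it is nonzero because \<zeta> avoids
        0, 1 and every u_m on \<Omega>.\<close>
      define K where "K = - (\<zeta> * (\<zeta> - 1) * (\<Prod>m\<in>UNIV. \<zeta> - v $ m) / (W \<zeta> v)\<^sup>2)"
      have "K \<noteq> 0"
        using branch_of_W_nonzero[OF assms(3) mem] by (simp add: K_def)
      \<comment> \<open>Interchanging the sums over i and l collects the Bezoutians of the three
        pairs.\<close>
      have "(\<Sum>l<?n. E l * \<zeta> ^ l)
          = (\<Sum>i\<in>UNIV. ((\<Sum>l<?n. bezout_coeff ?n (\<phi>1 v) (\<phi>2 v) (v $ i) l * \<zeta> ^ l) / D v i) * uy $ i)
          + (\<Sum>i\<in>UNIV. ((\<Sum>l<?n. bezout_coeff ?n (\<phi>2 v) (\<phi> v) (v $ i) l * \<zeta> ^ l) / D v i) * ut $ i)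
          + (\<Sum>i\<in>UNIV. ((\<Sum>l<?n. bezout_coeff ?n (\<phi> v) (\<phi>1 v) (v $ i) l * \<zeta> ^ l) / D v i) * ux $ i)"
        unfolding E_def sum_distrib_right sum_divide_distrib
        by (subst sum.swap) (simp add: sum.distrib[symmetric] add_divide_distrib algebra_simps)
      then have "K * (\<Sum>l<?n. E l * \<zeta> ^ l) =
          (\<Sum>i\<in>UNIV. K * ((\<Sum>l<?n. bezout_coeff ?n (\<phi>1 v) (\<phi>2 v) (v $ i) l * \<zeta> ^ l) / D v i) * uy $ i)
          + (\<Sum>i\<in>UNIV. K * ((\<Sum>l<?n. bezout_coeff ?n (\<phi>2 v) (\<phi> v) (v $ i) l * \<zeta> ^ l) / D v i) * ut $ i)
          + (\<Sum>i\<in>UNIV. K * ((\<Sum>l<?n. bezout_coeff ?n (\<phi> v) (\<phi>1 v) (v $ i) l * \<zeta> ^ l) / D v i) * ux $ i)"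
        by (simp only: distrib_left sum_distrib_left mult.assoc)
      then show ?thesis
        \<comment> \<open>The brackets multiplying \<open>uy\<close>, \<open>ut\<close>,
          \<open>ux\<close> belong to the pairs (G, H), (H, F), (F, G), in the same cyclic order as
          in \<open>E\<close>.\<close>
        unfolding Let_def
          potential_bracket[OF pot(2,3) mem deg(2,3)] potential_bracket[OF pot(3,1) mem deg(3,1)]
          potential_bracket[OF pot(1,2) mem deg(1,2)] K_def[symmetric]
        using \<open>K \<noteq> 0\<close> by (metis mult_eq_0_iff)
    qed
    then show ?thesis
      by (simp add: compatible_def S_def)
  qed
  ultimately show ?thesis
    by (simp add: polyfun_zero_on_open_iff coeff_system_eq_iff_bezout E_def)
qed

theorem proposition2:
  fixes s1 s2 :: complex and s :: "'n::finite \<Rightarrow> complex"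
    and \<Omega> :: "(complex \<times> (complex ^ 'n)) set" and U :: "(complex ^ 'n) set"
    and \<phi> \<phi>1 \<phi>2 :: "complex ^ 'n \<Rightarrow> complex poly"
    and W F G H :: "complex \<Rightarrow> complex ^ 'n \<Rightarrow> complex"
    and X :: "(complex \<times> complex \<times> complex) set"
    and u :: "complex \<Rightarrow> complex \<Rightarrow> complex \<Rightarrow> complex ^ 'n"
  assumes "CARD('n) \<ge> 2"
    and "open \<Omega>" and "U = snd ` \<Omega>" and "\<forall>v\<in>U. admissible v"
    and "solves_L s1 s2 s U \<phi>" and "solves_L s1 s2 s U \<phi>1" and "solves_L s1 s2 s U \<phi>2"
    and "lin_indep3 U \<phi> \<phi>1 \<phi>2"
    and "branch_of_W s1 s2 s \<Omega> W"
    and "is_potential \<Omega> W \<phi> F" and "is_potential \<Omega> W \<phi>1 G" and "is_potential \<Omega> W \<phi>2 H"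
    and "open X"
    and "\<forall>(x, y, t) \<in> X. u x y t \<in> U"
    and "\<forall>(x, y, t) \<in> X. \<forall>i.
           (\<lambda>x'. u x' y t $ i) field_differentiable at x \<and>
           (\<lambda>y'. u x y' t $ i) field_differentiable at y \<and>
           (\<lambda>t'. u x y t' $ i) field_differentiable at t"
  shows "\<forall>(x, y, t) \<in> X.
    let ux = (\<chi> i. deriv (\<lambda>x'. u x' y t $ i) x);
        uy = (\<chi> i. deriv (\<lambda>y'. u x y' t $ i) y);
        ut = (\<chi> i. deriv (\<lambda>t'. u x y t' $ i) t)
    in compatible \<Omega> F G H (u x y t) ux uy ut \<longleftrightarrow>
       (\<forall>l < CARD('n). coeff_system_eq (\<phi> (u x y t)) (\<phi>1 (u x y t)) (\<phi>2 (u x y t)) l (u x y t) ux uy ut)"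
proof -
  have "degree (\<phi> v) \<le> CARD('n)" "degree (\<phi>1 v) \<le> CARD('n)" "degree (\<phi>2 v) \<le> CARD('n)"
    if "v \<in> U" for v
    using that assms(5-7) by (auto simp: solves_L_def)
  then have "compatible \<Omega> F G H v ux uy ut \<longleftrightarrow>
      (\<forall>l < CARD('n). coeff_system_eq (\<phi> v) (\<phi>1 v) (\<phi>2 v) l v ux uy ut)" if "v \<in> U" for v ux uy ut
    using compatible_iff_coeff_system[OF assms(2) _ assms(9-12)] that assms(3) by blast
  then show ?thesis
    using assms(14) unfolding Let_def by blast
qed

end
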